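(* Let $K\ge 1$ and $n,d,d_k\ge1$ be integers, and let $\mathbf A^{(1)},\dots,\mathbf A^{(K)}\in\mathbb R^{n\times n}$ be attention matrices, i.e. each $\mathbf A^{(k)}=\mathrm{softmax}\big(\mathbf Q'_k\mathbf K_k'^{\top}/\sqrt{d_k}\big)$ for some $\mathbf Q'_k,\mathbf K'_k\in\mathbb R^{n\times d_k}$. Then there exist a matrix $\mathbf C^*\in\mathbb R^{n\times n}$ (associated with $\mathbf A^{(1)},\dots,\mathbf A^{(K)}$) and a step size $\eta>0$ such that, for every initial embedding matrix $\mathbf H^{(0)}\in\mathbb R^{n\times d}$, if $\mathbf H^{(1)},\dots,\mathbf H^{(K)}$ are the layer embeddings of the $K$-layer attention model defined by $$\mathbf H^{(k)}=\mathbf H^{(k-1)}+\mathbf A^{(k)}\mathbf H^{(k-1)},\qquad k=1,\dots,K,$$ then one gradient descent step with step size $\eta$, started at $\mathbf H=\mathbf H^{(0)}$, for the optimization problem $$\min_{\mathbf H\in\mathbb R^{n\times d}}\left\|\mathbf H-\mathbf C^*\mathbf H^{(0)}\right\|_2^2$$ yields the output embeddings $\mathbf H^{(K)}$ of the $K$-layer model. That is, with $E(\mathbf H)=\|\mathbf H-\mathbf C^*\mathbf H^{(0)}\|_2^2$, $$\mathbf H^{(K)}=\mathbf H^{(0)}-\eta\,\nabla E(\mathbf H)\big|_{\mathbf H=\mathbf H^{(0)}} .$$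
   Context: The norm $\|\cdot\|_2$ of a matrix denotes the entrywise Euclidean (Frobenius) norm, so $\|\mathbf M\|_2^2=\sum_{i,j}M_{ij}^2$. $\nabla E$ is the gradient with respect to the entries of $\mathbf H$, and softmax is applied row by row. In $E$, the matrices $\mathbf C^*$ and $\mathbf H^{(0)}$ are held fixed (not differentiated). A gradient descent step with step size $\eta$ for minimizing $E$ started at $\mathbf H_0$ is $\mathbf H_0\mapsto \mathbf H_0-\eta\nabla E(\mathbf H_0)$. *)

theory Defs
  imports "HOL-Analysis.Analysis"
begin

definition softmax :: "real ^ 'n \<Rightarrow> real ^ 'n::finite" where
  "softmax v = (\<chi> i. exp (v $ i) / (\<Sum>j\<in>UNIV. exp (v $ j)))"

definition softmax_rows :: "real ^ 'm ^ 'n \<Rightarrow> real ^ 'm::finite ^ 'n::finite" where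
  "softmax_rows M = (\<chi> i. softmax (M $ i))"

(* The common column dimension d_k of the query and key matrices is CARD('m). *)
definition attention :: "real ^ 'm ^ 'n \<Rightarrow> real ^ 'm ^ 'n \<Rightarrow> real ^ 'n::finite ^ 'n" where
  "attention Q K = softmax_rows ((1 / sqrt (real CARD('m::finite))) *\<^sub>R (Q ** transpose K))"

(* A relation rather than a function, so that it includes differentiability of E at x. *)
definition gradient_descent_step :: "real \<Rightarrow> ('a::real_inner \<Rightarrow> real) \<Rightarrow> 'a \<Rightarrow> 'a \<Rightarrow> bool" where
  "gradient_descent_step \<eta> E x y \<longleftrightarrow> (\<exists>g. GDERIV E x :> g \<and> y = x - \<eta> *\<^sub>R g)"

(* The library norm on matrices is the Frobenius norm, and the gradient with respect to the
   library inner product is the matrix of partial derivatives with respect to the entries. *)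
lemma norm_matrix_eq_Frobenius:
  fixes M :: "real ^ 'd::finite ^ 'n::finite"
  shows "(norm M)\<^sup>2 = (\<Sum>i\<in>UNIV. \<Sum>j\<in>UNIV. (M $ i $ j)\<^sup>2)"
  unfolding power2_norm_eq_inner inner_vec_def by (simp add: power2_eq_square)

lemma GDERIV_matrix_entry:
  fixes E :: "real ^ 'd::finite ^ 'n::finite \<Rightarrow> real"
  assumes "GDERIV E H :> G"
  shows "((\<lambda>t. E (H + t *\<^sub>R axis i (axis j 1))) has_real_derivative G $ i $ j) (at 0)"
proof -
  let ?B = "axis i (axis j 1) :: real ^ 'd ^ 'n"
  have E: "(E has_derivative (\<lambda>h. h \<bullet> G)) (at (H + 0 *\<^sub>R ?B))"
    using assms by (simp add: gderiv_def)
  have "((\<lambda>t::real. H + t *\<^sub>R ?B) has_derivative (\<lambda>t. t *\<^sub>R ?B)) (at 0)"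
    by (auto intro!: derivative_eq_intros)
  from has_derivative_compose[OF this E]
  show ?thesis
    by (simp add: has_field_derivative_def inner_axis' mult.commute[of _ "G $ i $ j"])
qed

end

theory Submission imports Defs begin

text \<open>The residual recursion is linear in the embedding: after \<open>k\<close> layers the embedding is
  \<open>C\<^sub>k H\<^sub>0\<close> with \<open>C\<^sub>k = (I + A\<^sub>k) \<cdots> (I + A\<^sub>1)\<close>. The gradient of \<open>\<parallel>X - C\<^sub>K H\<^sub>0\<parallel>\<^sup>2\<close> is
  \<open>2 (X - C\<^sub>K H\<^sub>0)\<close>, so a step of size \<open>1/2\<close> lands exactly on the minimizer \<open>C\<^sub>K H\<^sub>0\<close>,
  from any starting point.\<close>

text \<open>The product rule for the inner product yields two terms that agree by symmetry, hence
  the factor 2.\<close>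

lemma GDERIV_norm_diff_squared:
  fixes b x :: "'a::real_inner"
  shows "GDERIV (\<lambda>x. (norm (x - b))\<^sup>2) x :> 2 *\<^sub>R (x - b)"
  unfolding gderiv_def power2_norm_eq_inner
  by (auto intro!: derivative_eq_intros simp: inner_commute)

lemma gradient_descent_step_norm_diff_squared:
  "gradient_descent_step (1 / 2) (\<lambda>x. (norm (x - b))\<^sup>2) x b"
  unfolding gradient_descent_step_def
  by (intro exI[of _ "2 *\<^sub>R (x - b)"] conjI GDERIV_norm_diff_squared) simp

primrec residual_product :: "(nat \<Rightarrow> real ^ 'n ^ 'n) \<Rightarrow> nat \<Rightarrow> real ^ 'n ^ 'n::finite" where
  "residual_product A 0 = mat 1"
| "residual_product A (Suc k) = (mat 1 + A (Suc k)) ** residual_product A k"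

lemma matrix_mult_add_left:
  fixes A B :: "'a::semiring_1 ^ 'n::finite ^ 'm"
  shows "(A + B) ** C = A ** C + B ** C"
  by (simp add: matrix_matrix_mult_def vec_eq_iff distrib_right sum.distrib)

lemma residual_recursion_eq_product:
  fixes H :: "nat \<Rightarrow> real ^ 'd ^ 'n::finite"
  assumes "\<forall>k\<in>{1..K}. H k = H (k - 1) + A k ** H (k - 1)" and "k \<le> K"
  shows "H k = residual_product A k ** H 0"
  using assms(2)
proof (induction k)
  case (Suc k)
  \<comment> \<open>\<open>Suc k\<close> lies in \<open>{1..K}\<close>, and \<open>Suc k - 1\<close>
    is \<open>k\<close>.\<close>
  have "H (Suc k) = H k + A (Suc k) ** H k"
    using assms(1) Suc.prems by force
  with Suc show ?case
    by (simp add: matrix_mult_add_left flip: matrix_mul_assoc)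
qed simp

theorem proposition2:
  fixes K :: nat
    and A :: "nat \<Rightarrow> real ^ 'n::finite ^ 'n"
  assumes "K \<ge> 1"
    and "\<forall>k\<in>{1..K}. \<exists>(Q :: real ^ 'm::finite ^ 'n) (K' :: real ^ 'm ^ 'n). A k = attention Q K'"
  shows "\<exists>(C :: real ^ 'n ^ 'n) (\<eta> :: real). \<eta> > 0 \<and>
    (\<forall>H :: nat \<Rightarrow> real ^ 'd::finite ^ 'n.
      (\<forall>k\<in>{1..K}. H k = H (k - 1) + A k ** H (k - 1)) \<longrightarrow>
      gradient_descent_step \<eta> (\<lambda>X. (norm (X - C ** H 0))\<^sup>2) (H 0) (H K))"
\<comment> \<open>Both witnesses stay schematic until the final \<open>show\<close> sets them to
  \<open>residual_product A K\<close> and \<open>1 / 2\<close>. They are introduced before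
  \<open>H\<close> is fixed, so they cannot depend on it.\<close>
proof (intro exI conjI allI impI)
  fix H :: "nat \<Rightarrow> real ^ 'd ^ 'n"
  assume "\<forall>k\<in>{1..K}. H k = H (k - 1) + A k ** H (k - 1)"
  then have "H K = residual_product A K ** H 0"
    by (rule residual_recursion_eq_product) simp
  then show "gradient_descent_step (1 / 2)
      (\<lambda>X. (norm (X - residual_product A K ** H 0))\<^sup>2) (H 0) (H K)"
    by (simp only: gradient_descent_step_norm_diff_squared)
qed simp

end
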